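(* Let $\{G_n\}_{n\ge1}$ be a sequence of graphs with finite diameters satisfying $\mathrm{diam}(G_n)=\omega(1)$, and let $\{r_n\}_{n\ge1}$ be positive integers with $r_n=\varepsilon\cdot\mathrm{diam}(G_n)$. Then $$\lambda_2\big(G_n^{(r_n)}\big)\ge (1-o_\varepsilon(1))\,(r_n+1)\,\hat d_{r_n}(G_n)^{\,r_n/2},$$ where $\hat d_r(G)=\Big(\frac{1}{r+1}\sum_{i=0}^{r}\sqrt{\delta^{(i)}(G)\,\delta^{(r-i)}(G)}\Big)^{2/r}$ and $\delta^{(i)}(G)=\min_{(x,y)\in E(G)}\big|\{v\in V(G): d_G(x,v)=i,\ d_G(y,v)\ge i\}\big|$.
   Context: For a graph $G$ and integer $r\ge1$, $G^{(r)}$ is the graph on $V(G)$ in which two vertices are adjacent iff they are at distance $\le r$ in $G$; its adjacency matrix $A^{(r)}$ has $A^{(r)}_{ij}=1$ iff $d_G(i,j)\le r$ (diagonal entries $1$), and $\lambda_2(G^{(r)})$ denotes the second largest eigenvalue of $A^{(r)}$. The minimum defining $\delta^{(i)}$ is over ordered pairs $(x,y)$ of adjacent vertices. $o_\varepsilon(1)$ denotes a quantity tending to $0$ as $\varepsilon\to0$. *)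

theory Defs
  imports Complex_Main "Jordan_Normal_Form.Char_Poly"
begin

definition is_graph :: "nat \<Rightarrow> (nat \<Rightarrow> nat \<Rightarrow> bool) \<Rightarrow> bool" where
  "is_graph N E \<longleftrightarrow> N \<ge> 1 \<and> (\<forall>x y. E x y \<longrightarrow> x < N \<and> y < N \<and> x \<noteq> y \<and> E y x)"

inductive walk :: "(nat \<Rightarrow> nat \<Rightarrow> bool) \<Rightarrow> nat \<Rightarrow> nat \<Rightarrow> nat \<Rightarrow> bool"
  for E where
  walk_refl: "walk E x x 0"
| walk_step: "E x z \<Longrightarrow> walk E z y k \<Longrightarrow> walk E x y (Suc k)"

text \<open>Finite diameter = every two vertices are joined by a walk.\<close>
definition connected_graph :: "nat \<Rightarrow> (nat \<Rightarrow> nat \<Rightarrow> bool) \<Rightarrow> bool" where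
  "connected_graph N E \<longleftrightarrow> (\<forall>x<N. \<forall>y<N. \<exists>k. walk E x y k)"

definition gdist :: "(nat \<Rightarrow> nat \<Rightarrow> bool) \<Rightarrow> nat \<Rightarrow> nat \<Rightarrow> nat" where
  "gdist E x y = (LEAST k. walk E x y k)"

definition diam :: "nat \<Rightarrow> (nat \<Rightarrow> nat \<Rightarrow> bool) \<Rightarrow> nat" where
  "diam N E = Max {gdist E x y | x y. x < N \<and> y < N}"

text \<open>Adjacency matrix of the r-th power G^(r) (diagonal entries 1).\<close>
definition power_adj :: "nat \<Rightarrow> (nat \<Rightarrow> nat \<Rightarrow> bool) \<Rightarrow> nat \<Rightarrow> real mat" where
  "power_adj N E r = mat N N (\<lambda>(i, j). if gdist E i j \<le> r then 1 else 0)"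

definition eigenvalues_desc :: "real mat \<Rightarrow> real list" where
  "eigenvalues_desc A = rev (sorted_list_of_multiset (proots (char_poly A)))"

definition lambda2 :: "real mat \<Rightarrow> real" where
  "lambda2 A = eigenvalues_desc A ! 1"

definition delta :: "nat \<Rightarrow> (nat \<Rightarrow> nat \<Rightarrow> bool) \<Rightarrow> nat \<Rightarrow> nat" where
  "delta N E i = Min {card {v. v < N \<and> gdist E x v = i \<and> gdist E y v \<ge> i} | x y. E x y}"

definition dhat :: "nat \<Rightarrow> (nat \<Rightarrow> nat \<Rightarrow> bool) \<Rightarrow> nat \<Rightarrow> real" where
  "dhat N E r = ((1 / real (r + 1)) *
      (\<Sum>i = 0..r. sqrt (real (delta N E i) * real (delta N E (r - i))))) powr (2 / real r)"

end

theory Submission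
  imports Defs "Jordan_Normal_Form.Spectral_Radius"
begin

text \<open>Write \<open>c = (\<Sum>i\<le>r. sqrt (\<delta> i * \<delta> (r - i)))\<close>, so that the claimed bound is \<open>(1 - o(1)) * c\<close>.
  If the adjacency matrix of the power, restricted to the ball of radius \<open>n\<close> around \<open>x\<close>, had all
  eigenvalues below \<open>s\<close>, its resolvent at \<open>s\<close> would map the all-ones vector to a positive \<open>g\<close> with
  \<open>s * g > A g\<close>. Let \<open>h l\<close> be the minimum of \<open>g\<close> over the endpoints of walks of length \<open>l\<close> from \<open>x\<close>.
  Following a walk to the minimiser backwards gives
  \<open>s * h l > (\<Sum>a. \<delta> (r - a) * h (l + r - 2 * a))\<close>; dividing by \<open>h l\<close>, summing over \<open>l \<le> n\<close> and pairing
  \<open>a\<close> with \<open>r - a\<close> by AM-GM yields \<open>s * n > (n - r) * c\<close>. Hence balls of radius \<open>n\<close> carry test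
  functions with Rayleigh quotient at least \<open>(1 - r / n) * c\<close>. Two such balls around the ends of a
  diameter are more than \<open>r\<close> apart when \<open>2 * n + r\<close> is less than the diameter, and the plane spanned
  by their test functions bounds the second eigenvalue from below by the min-max principle.
  With \<open>n\<close> about half the diameter, \<open>r / n \<le> 4 * \<epsilon>\<close>.\<close>

subsection \<open>Spectral theorem and min-max principle for real symmetric matrices\<close>

lemma scalar_prod_symmetric_mat:
  fixes A :: "'a :: comm_semiring_0 mat"
  assumes A: "A \<in> carrier_mat n n" and sym: "transpose_mat A = A"
    and x: "x \<in> carrier_vec n" and y: "y \<in> carrier_vec n"
  shows "x \<bullet> (A *\<^sub>v y) = y \<bullet> (A *\<^sub>v x)"
proof -
  have "(transpose_mat A *\<^sub>v x) \<bullet> y = x \<bullet> (A *\<^sub>v y)"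
    using transpose_vec_mult_scalar[OF A y x] by simp
  then show ?thesis
    using sym A x y comm_scalar_prod[of "A *\<^sub>v x" n y] by simp
qed

text \<open>A complex eigenvector \<open>z = x + i y\<close> for \<open>k\<close> exists. Since
  \<open>A\<close> is real, comparing real and imaginary parts gives real equations for
  \<open>A x\<close> and \<open>A y\<close>. Symmetry then forces
  \<open>Im k * (x \<bullet> x + y \<bullet> y) = 0\<close>, so \<open>k\<close> is real and
  whichever of \<open>x\<close>, \<open>y\<close> is nonzero serves as eigenvector.\<close>

lemma symmetric_mat_real_eigenvector:
  fixes A :: "real mat"
  assumes A: "A \<in> carrier_mat n n" and sym: "transpose_mat A = A" and n: "n > 0"
  shows "\<exists>e v. v \<in> carrier_vec n \<and> v \<noteq> 0\<^sub>v n \<and> A *\<^sub>v v = e \<cdot>\<^sub>v v"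
proof -
  let ?C = "map_mat complex_of_real A"
  have C: "?C \<in> carrier_mat n n" using A by simp
  from spectrum_non_empty[OF C n] obtain k where "eigenvalue ?C k"
    unfolding spectrum_def by auto
  then obtain z where z: "z \<in> carrier_vec n" "z \<noteq> 0\<^sub>v n" and ev: "?C *\<^sub>v z = k \<cdot>\<^sub>v z"
    using A unfolding eigenvalue_def eigenvector_def by auto
  define x where "x = map_vec Re z"
  define y where "y = map_vec Im z"
  have x: "x \<in> carrier_vec n" and y: "y \<in> carrier_vec n" using z unfolding x_def y_def by auto
  have cz: "(\<Sum>j = 0..<n. complex_of_real (A $$ (i,j)) * z $ j) = k * z $ i" if "i < n" for i
  proof -
    have "(?C *\<^sub>v z) $ i = (k \<cdot>\<^sub>v z) $ i" using ev by simp
    then show ?thesis using that A z by (simp add: scalar_prod_def row_def)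
  qed
  have Ax: "A *\<^sub>v x = Re k \<cdot>\<^sub>v x - Im k \<cdot>\<^sub>v y"
  proof (rule eq_vecI)
    fix i assume "i < dim_vec (Re k \<cdot>\<^sub>v x - Im k \<cdot>\<^sub>v y)"
    then have i: "i < n" using x y by simp
    show "(A *\<^sub>v x) $ i = (Re k \<cdot>\<^sub>v x - Im k \<cdot>\<^sub>v y) $ i"
      using i A z arg_cong[OF cz[OF i], of Re] by (simp add: scalar_prod_def row_def x_def y_def)
  qed (use A x y in simp)
  have Ay: "A *\<^sub>v y = Im k \<cdot>\<^sub>v x + Re k \<cdot>\<^sub>v y"
  proof (rule eq_vecI)
    fix i assume "i < dim_vec (Im k \<cdot>\<^sub>v x + Re k \<cdot>\<^sub>v y)"
    then have i: "i < n" using x y by simp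
    show "(A *\<^sub>v y) $ i = (Im k \<cdot>\<^sub>v x + Re k \<cdot>\<^sub>v y) $ i"
      using i A z arg_cong[OF cz[OF i], of Im]
      by (simp add: scalar_prod_def row_def x_def y_def algebra_simps)
  qed (use A x y in simp)
  have xy: "x \<noteq> 0\<^sub>v n \<or> y \<noteq> 0\<^sub>v n"
  proof (rule ccontr)
    assume "\<not> ?thesis"
    then have "x = 0\<^sub>v n" "y = 0\<^sub>v n" by auto
    then have "x $ i = 0" "y $ i = 0" if "i < n" for i using that by auto
    then have "Re (z $ i) = 0" "Im (z $ i) = 0" if "i < n" for i
      using that z unfolding x_def y_def by auto
    then have "z = 0\<^sub>v n" using z by (intro eq_vecI) (auto simp: complex_eq_iff)
    with z show False by simp
  qed
  have "y \<bullet> (A *\<^sub>v x) = x \<bullet> (A *\<^sub>v y)" by (rule scalar_prod_symmetric_mat[OF A sym y x])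
  then have "Im k * (x \<bullet> x + y \<bullet> y) = 0"
    unfolding Ax Ay using x y comm_scalar_prod[OF x y]
    by (simp add: scalar_prod_add_distrib[of _ n] scalar_prod_minus_distrib[of _ n] algebra_simps)
  moreover have "x \<bullet> x + y \<bullet> y > 0"
    using xy x y conjugate_square_greater_0_vec[of x n] conjugate_square_greater_0_vec[of y n]
      conjugate_square_ge_0_vec[of x] conjugate_square_ge_0_vec[of y]
    by (auto simp: add_pos_nonneg add_nonneg_pos)
  ultimately have "Im k = 0" by auto
  then have "A *\<^sub>v x = Re k \<cdot>\<^sub>v x" "A *\<^sub>v y = Re k \<cdot>\<^sub>v y"
    unfolding Ax Ay using x y by (auto intro!: eq_vecI)
  with xy x y show ?thesis by blast
qed

text \<open>The reflection in the hyperplane orthogonal to \<open>v - unit_vec n 0\<close> exchanges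
  these two vectors because they have the same length. It supplies an orthogonal change of basis
  that is its own inverse.\<close>

lemma householder_reflection:
  fixes v :: "real vec"
  assumes v: "v \<in> carrier_vec n" and norm: "v \<bullet> v = 1" and n: "n > 0"
  shows "\<exists>H \<in> carrier_mat n n. transpose_mat H = H \<and> H * H = 1\<^sub>m n \<and> H *\<^sub>v unit_vec n 0 = v"
proof -
  define w where "w = v - unit_vec n 0"
  have w: "w \<in> carrier_vec n" using v unfolding w_def by simp
  \<comment> \<open>If \<open>v\<close> is the first unit vector then \<open>w = 0\<close> and \<open>c = 2 / 0 = 0\<close>, so that \<open>H\<close> is the identity.\<close>
  define c where "c = 2 / (w \<bullet> w)"
  define H where "H = mat n n (\<lambda>(i, j). (if i = j then 1 else 0) - c * (w $ i * w $ j))"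
  have H: "H \<in> carrier_mat n n" unfolding H_def by simp
  have Ht: "transpose_mat H = H" unfolding H_def by (intro eq_matI) auto
  have ww: "(\<Sum>k = 0..<n. w $ k * w $ k) = w \<bullet> w" using w by (simp add: scalar_prod_def)
  have cc: "c * c * (w \<bullet> w) = 2 * c" unfolding c_def by (simp add: field_simps)
  have "H * H = 1\<^sub>m n"
  proof (rule eq_matI)
    fix i j assume "i < dim_row (1\<^sub>m n :: real mat)" "j < dim_col (1\<^sub>m n :: real mat)"
    then have ij: "i < n" "j < n" by auto
    have "(H * H) $$ (i, j) = (\<Sum>k = 0..<n. ((if i = k then 1 else 0) - c * (w $ i * w $ k))
        * ((if k = j then 1 else 0) - c * (w $ k * w $ j)))"
      using ij unfolding H_def by (simp add: scalar_prod_def row_def col_def)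
    also have "\<dots> = (\<Sum>k = 0..<n. (if i = k then (if k = j then 1 else 0) - c * (w $ k * w $ j) else 0)
        - (if k = j then c * (w $ i * w $ k) else 0) + c * c * w $ i * w $ j * (w $ k * w $ k))"
      by (intro sum.cong) (auto simp: algebra_simps)
    also have "\<dots> = (if i = j then 1 else 0) - 2 * c * (w $ i * w $ j)
        + c * c * w $ i * w $ j * (w \<bullet> w)"
      using ij by (simp add: sum.distrib sum_subtractf sum_distrib_left[symmetric] ww)
    also have "c * c * w $ i * w $ j * (w \<bullet> w) = c * c * (w \<bullet> w) * (w $ i * w $ j)" by simp
    finally show "(H * H) $$ (i, j) = 1\<^sub>m n $$ (i, j)" using ij unfolding cc by simp
  qed (use H in auto)
  moreover have "H *\<^sub>v unit_vec n 0 = v"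
  proof (rule eq_vecI)
    fix i assume "i < dim_vec v"
    then have i: "i < n" using v by simp
    have "(H *\<^sub>v unit_vec n 0) $ i = (if i = 0 then 1 else 0) - c * (w $ i * w $ 0)"
      using i n unfolding H_def by (simp add: scalar_prod_def row_def unit_vec_def if_distrib cong: if_cong)
    moreover have "(if i = 0 then 1 else 0) = v $ i - w $ i"
      using i v n unfolding w_def by (simp add: unit_vec_def)
    moreover have "- c * w $ 0 * w $ i = w $ i"
    proof (cases "w = 0\<^sub>v n")
      case False
      have "w \<bullet> w = v \<bullet> v - 2 * (v $ 0) + 1"
        unfolding w_def using v n
        by (simp add: scalar_prod_minus_distrib[of _ n] minus_scalar_prod_distrib[of _ n])
      then have "w \<bullet> w = - 2 * (w $ 0)" using norm v n unfolding w_def by (simp add: unit_vec_def)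
      moreover have "w \<bullet> w \<noteq> 0" using conjugate_square_eq_0_vec[OF w] False by simp
      ultimately have "- c * w $ 0 = 1" unfolding c_def by (simp add: field_simps)
      then show ?thesis by simp
    qed (use i in simp)
    ultimately show "(H *\<^sub>v unit_vec n 0) $ i = v $ i" by (simp add: algebra_simps)
  qed (use v H in simp)
  ultimately show ?thesis using H Ht by blast
qed

text \<open>Deflation: conjugating by a reflection that takes the first unit vector to a unit
  eigenvector makes the first column a multiple of that unit vector. By symmetry the first row has
  the same shape, so a smaller symmetric block splits off and the induction hypothesis applies to
  it.\<close>

theorem symmetric_mat_orthogonally_diagonalizable:
  fixes A :: "real mat"
  assumes "A \<in> carrier_mat n n" "transpose_mat A = A"
  shows "\<exists>P \<in> carrier_mat n n. transpose_mat P * P = 1\<^sub>m n \<and>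
    diagonal_mat (transpose_mat P * A * P)"
  using assms
proof (induction n arbitrary: A)
  case 0
  then show ?case by (intro bexI[of _ "1\<^sub>m 0"]) (auto simp: diagonal_mat_def)
next
  case (Suc n)
  note A = Suc.prems(1) and sym = Suc.prems(2)
  obtain e v0 where v0: "v0 \<in> carrier_vec (Suc n)" "v0 \<noteq> 0\<^sub>v (Suc n)" and ev0: "A *\<^sub>v v0 = e \<cdot>\<^sub>v v0"
    using symmetric_mat_real_eigenvector[OF A sym] by auto
  define v where "v = (1 / sqrt (v0 \<bullet> v0)) \<cdot>\<^sub>v v0"
  have v: "v \<in> carrier_vec (Suc n)" using v0 unfolding v_def by simp
  have "v0 \<bullet> v0 > 0" using conjugate_square_greater_0_vec[OF v0(1)] v0(2) by simp
  then have norm: "v \<bullet> v = 1" unfolding v_def using v0 by simp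
  have ev: "A *\<^sub>v v = e \<cdot>\<^sub>v v"
    unfolding v_def using A v0 by (simp add: mult_mat_vec[of _ "Suc n" "Suc n"] ev0 smult_smult_assoc mult.commute)
  obtain H where H: "H \<in> carrier_mat (Suc n) (Suc n)" and Ht: "transpose_mat H = H"
    and HH: "H * H = 1\<^sub>m (Suc n)" and He: "H *\<^sub>v unit_vec (Suc n) 0 = v"
    using householder_reflection[OF v norm] by auto
  define B where "B = H * A * H"
  have B: "B \<in> carrier_mat (Suc n) (Suc n)" unfolding B_def using H A by simp
  have Bt: "transpose_mat B = B"
  proof -
    have "transpose_mat B = transpose_mat H * transpose_mat (H * A)"
      unfolding B_def by (rule transpose_mult) (use H A in auto)
    also have "transpose_mat (H * A) = transpose_mat A * transpose_mat H"
      by (rule transpose_mult) (use H A in auto)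
    finally show ?thesis unfolding Ht sym B_def using H A by (simp add: assoc_mult_mat[of _ "Suc n" "Suc n" _ "Suc n" _ "Suc n"])
  qed
  have Hv: "H *\<^sub>v v = unit_vec (Suc n) 0"
    unfolding He[symmetric] using H HH by (simp add: assoc_mult_mat_vec[of _ "Suc n" "Suc n" _ "Suc n", symmetric])
  have "B *\<^sub>v unit_vec (Suc n) 0 = H *\<^sub>v (A *\<^sub>v (H *\<^sub>v unit_vec (Suc n) 0))"
    unfolding B_def using H A by (simp add: assoc_mult_mat_vec[of _ "Suc n" "Suc n" _ "Suc n"])
  also have "\<dots> = e \<cdot>\<^sub>v unit_vec (Suc n) 0"
    unfolding He ev using H v by (simp add: mult_mat_vec[of _ "Suc n" "Suc n"] Hv)
  finally have Be: "B *\<^sub>v unit_vec (Suc n) 0 = e \<cdot>\<^sub>v unit_vec (Suc n) 0" .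
  have col0: "B $$ (i, 0) = (if i = 0 then e else 0)" if "i < Suc n" for i
  proof -
    have "(B *\<^sub>v unit_vec (Suc n) 0) $ i = B $$ (i, 0)" using that B by simp
    then show ?thesis unfolding Be using that by (auto simp: unit_vec_def split: if_splits)
  qed
  have Bsym: "B $$ (i, j) = B $$ (j, i)" if "i < Suc n" "j < Suc n" for i j
    using that B index_transpose_mat(1)[of i B j] unfolding Bt by auto
  define A' where "A' = mat n n (\<lambda>(i, j). B $$ (Suc i, Suc j))"
  have A': "A' \<in> carrier_mat n n" unfolding A'_def by simp
  have A't: "transpose_mat A' = A'" unfolding A'_def by (intro eq_matI) (auto intro: Bsym)
  have Bblock: "B = four_block_mat (mat 1 1 (\<lambda>_. e)) (0\<^sub>m 1 n) (0\<^sub>m n 1) A'"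
    using B col0 Bsym[of 0] unfolding A'_def by (intro eq_matI) auto
  obtain P where P: "P \<in> carrier_mat n n" and PP: "transpose_mat P * P = 1\<^sub>m n"
    and D: "diagonal_mat (transpose_mat P * A' * P)"
    using Suc.IH[OF A' A't] by auto
  define Q where "Q = four_block_mat (1\<^sub>m 1) (0\<^sub>m 1 n) (0\<^sub>m n 1) P"
  have Q: "Q \<in> carrier_mat (Suc n) (Suc n)" unfolding Q_def using P by auto
  have Qt: "transpose_mat Q = four_block_mat (1\<^sub>m 1) (0\<^sub>m 1 n) (0\<^sub>m n 1) (transpose_mat P)"
    unfolding Q_def using P by (subst transpose_four_block_mat[of _ 1 1 _ n _ n]) auto
  have QQ: "transpose_mat Q * Q = 1\<^sub>m (Suc n)"
  proof -
    have "transpose_mat Q * Q = four_block_mat (1\<^sub>m 1) (0\<^sub>m 1 n) (0\<^sub>m n 1) (1\<^sub>m n)"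
      unfolding Qt unfolding Q_def using P PP
      by (subst mult_four_block_mat[of _ 1 1 _ n _ n _ _ 1 _ n]) auto
    also have "\<dots> = 1\<^sub>m (Suc n)" by (intro eq_matI) auto
    finally show ?thesis .
  qed
  have "transpose_mat Q * B * Q =
      four_block_mat (mat 1 1 (\<lambda>_. e)) (0\<^sub>m 1 n) (0\<^sub>m n 1) (transpose_mat P * A' * P)"
    unfolding Qt unfolding Q_def Bblock using P A'
    apply (subst mult_four_block_mat[of _ 1 1 _ n _ n _ _ 1 _ n]; simp)
    apply (subst mult_four_block_mat[of _ 1 1 _ n _ n _ _ 1 _ n]; simp)
    done
  moreover have "diagonal_mat (four_block_mat (mat 1 1 (\<lambda>_. e)) (0\<^sub>m 1 n) (0\<^sub>m n 1) D)"
    if "D \<in> carrier_mat n n" "diagonal_mat D" for D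
    using that unfolding diagonal_mat_def by (auto simp: less_Suc_eq_0_disj; blast)
  ultimately have DQ: "diagonal_mat (transpose_mat Q * B * Q)" using D P A' by simp
  have "transpose_mat (H * Q) = transpose_mat Q * H"
    using transpose_mult[OF H Q] Ht by simp
  moreover have "transpose_mat Q * H * (H * Q) = 1\<^sub>m (Suc n)"
  proof -
    have "transpose_mat Q * H * (H * Q) = transpose_mat Q * (H * H) * Q"
      using H Q by (simp add: assoc_mult_mat[of _ "Suc n" "Suc n" _ "Suc n" _ "Suc n"])
    then show ?thesis using HH QQ Q by simp
  qed
  moreover have "transpose_mat Q * H * A * (H * Q) = transpose_mat Q * B * Q"
    unfolding B_def using H Q A by (simp add: assoc_mult_mat[of _ "Suc n" "Suc n" _ "Suc n" _ "Suc n"])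
  ultimately show ?case using DQ H Q by (intro bexI[of _ "H * Q"]) auto
qed

lemma symmetric_mat_spectral_coordinates:
  fixes A :: "real mat"
  assumes A: "A \<in> carrier_mat n n" and sym: "transpose_mat A = A"
  obtains P es where "P \<in> carrier_mat n n" "length es = n" "mset (eigenvalues_desc A) = mset es"
    "\<And>w. w \<in> carrier_vec n \<Longrightarrow> w \<bullet> w = (\<Sum>i<n. ((P *\<^sub>v w) $ i)\<^sup>2)"
    "\<And>w. w \<in> carrier_vec n \<Longrightarrow> w \<bullet> (A *\<^sub>v w) = (\<Sum>i<n. es ! i * ((P *\<^sub>v w) $ i)\<^sup>2)"
proof -
  obtain Q where Q: "Q \<in> carrier_mat n n" and QQ: "transpose_mat Q * Q = 1\<^sub>m n"
    and diag: "diagonal_mat (transpose_mat Q * A * Q)"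
    using symmetric_mat_orthogonally_diagonalizable[OF A sym] by auto
  define P where "P = transpose_mat Q"
  define D where "D = P * A * Q"
  have P: "P \<in> carrier_mat n n" unfolding P_def using Q by simp
  have D: "D \<in> carrier_mat n n" unfolding D_def using P Q A by simp
  have PQ: "P * Q = 1\<^sub>m n" unfolding P_def by (rule QQ)
  have QP: "Q * P = 1\<^sub>m n" by (rule mat_mult_left_right_inverse[OF P Q PQ])
  have dD: "D $$ (i, j) = 0" if "i < n" "j < n" "i \<noteq> j" for i j
    using diag that D unfolding D_def P_def diagonal_mat_def by auto
  have "Q * D * P = (Q * P) * A * (Q * P)"
    unfolding D_def using P Q A by (simp add: assoc_mult_mat[of _ n n _ n _ n])
  then have AD: "A = Q * D * P" unfolding QP using A by simp
  define es where "es = diag_mat D"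
  have len: "length es = n" unfolding es_def diag_mat_def using D by simp
  have es: "es ! i = D $$ (i, i)" if "i < n" for i
    unfolding es_def diag_mat_def using D that by simp
  have "similar_mat_wit A D Q P"
    unfolding similar_mat_wit_def Let_def using A D P Q QP PQ AD by auto
  then have "similar_mat A D" unfolding similar_mat_def by blast
  then have "char_poly A = char_poly D" by (rule char_poly_similar)
  also have "\<dots> = (\<Prod>a\<leftarrow>es. [:- a, 1:])"
    unfolding es_def by (rule char_poly_upper_triangular[OF D]) (use D dD in auto)
  finally have cp: "char_poly A = (\<Prod>a\<leftarrow>es. [:- a, 1:])" .
  \<comment> \<open>\<open>proots\<close> counts roots with multiplicity, so
    \<open>eigenvalues_desc\<close> is a rearrangement of the whole diagonal, repetitions
    included.\<close>
  have "proots (\<Prod>a\<leftarrow>es. [:- a, 1:]) = mset es" for es :: "real list"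
  proof (induction es)
    case (Cons a es)
    have "(\<Prod>a\<leftarrow>es. [:- a, 1:]) \<noteq> (0 :: real poly)"
      by (auto simp: prod_list_zero_iff)
    then have "proots ([:- a, 1:] * (\<Prod>a\<leftarrow>es. [:- a, 1:])) = {#a#} + mset es"
      using Cons.IH by (subst proots_mult) auto
    then show ?case by simp
  qed simp
  then have ms: "mset (eigenvalues_desc A) = mset es"
    unfolding eigenvalues_desc_def cp by simp
  have norm: "w \<bullet> w = (\<Sum>i<n. ((P *\<^sub>v w) $ i)\<^sup>2)" if w: "w \<in> carrier_vec n" for w
  proof -
    have Pw: "P *\<^sub>v w \<in> carrier_vec n" using P w by simp
    have "(P *\<^sub>v w) \<bullet> (P *\<^sub>v w) = w \<bullet> (Q *\<^sub>v (P *\<^sub>v w))"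
      using transpose_vec_mult_scalar[OF Q Pw w] unfolding P_def by simp
    also have "Q *\<^sub>v (P *\<^sub>v w) = w"
      using assoc_mult_mat_vec[OF Q P w] QP w by simp
    finally show ?thesis using P by (simp add: scalar_prod_def power2_eq_square lessThan_atLeast0)
  qed
  have form: "w \<bullet> (A *\<^sub>v w) = (\<Sum>i<n. es ! i * ((P *\<^sub>v w) $ i)\<^sup>2)" if w: "w \<in> carrier_vec n" for w
  proof -
    define y where "y = P *\<^sub>v w"
    have y: "y \<in> carrier_vec n" unfolding y_def using P w by simp
    have "A *\<^sub>v w = Q *\<^sub>v (D *\<^sub>v y)"
      unfolding AD y_def using P Q D w by (simp add: assoc_mult_mat_vec[of _ n n _ n])
    then have "w \<bullet> (A *\<^sub>v w) = y \<bullet> (D *\<^sub>v y)"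
      using transpose_vec_mult_scalar[OF Q _ w, of "D *\<^sub>v y"] D y unfolding y_def P_def by simp
    also have "\<dots> = (\<Sum>i<n. y $ i * (D *\<^sub>v y) $ i)"
      using D by (simp add: scalar_prod_def lessThan_atLeast0)
    also have "\<dots> = (\<Sum>i<n. es ! i * (y $ i)\<^sup>2)"
    proof (rule sum.cong)
      fix i assume "i \<in> {..<n}"
      then have i: "i < n" by simp
      have "(D *\<^sub>v y) $ i = (\<Sum>j<n. D $$ (i, j) * y $ j)"
        using i D y by (simp add: scalar_prod_def row_def lessThan_atLeast0)
      also have "\<dots> = (\<Sum>j<n. if j = i then D $$ (i, i) * y $ i else 0)"
        using dD[OF i] by (intro sum.cong) auto
      also have "\<dots> = es ! i * y $ i" using i es by simp
      finally show "y $ i * (D *\<^sub>v y) $ i = es ! i * (y $ i)\<^sup>2" by (simp add: power2_eq_square)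
    qed simp
    finally show ?thesis unfolding y_def .
  qed
  show ?thesis by (rule that[OF P len ms norm form])
qed

section \<open>Lower bound for the second eigenvalue from a plane of test vectors\<close>

lemma nth_1_ge_if_filter_ge:
  fixes xs :: "'a :: linorder list"
  assumes sorted: "sorted_wrt (\<ge>) xs" and two: "length (filter (\<lambda>x. c \<le> x) xs) \<ge> 2"
  shows "xs ! 1 \<ge> c"
proof (rule ccontr)
  assume less: "\<not> xs ! 1 \<ge> c"
  have "length xs \<ge> 2" using two length_filter_le[of _ xs] order_trans by blast
  then obtain a b ys where xs: "xs = a # b # ys"
    by (cases xs; cases "tl xs") auto
  have "filter (\<lambda>x. c \<le> x) (b # ys) = []"
    using less sorted unfolding xs by (auto simp: filter_empty_conv)
  then show False using two unfolding xs by (auto split: if_splits)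
qed

text \<open>If only one spectral coordinate belonged to an eigenvalue at least \<open>c\<close>,
  some nonzero vector of the plane would have that coordinate zero. All its other coordinates carry
  eigenvalues below \<open>c\<close>, so its form would fall strictly below \<open>c\<close> times
  its squared norm.\<close>

lemma lambda2_ge_if_form_ge_on_plane:
  fixes A :: "real mat"
  assumes A: "A \<in> carrier_mat n n" and sym: "transpose_mat A = A"
    and f: "f \<in> carrier_vec n" and g: "g \<in> carrier_vec n"
    and indep: "\<And>a b. a \<noteq> 0 \<or> b \<noteq> 0 \<Longrightarrow> a \<cdot>\<^sub>v f + b \<cdot>\<^sub>v g \<noteq> 0\<^sub>v n"
    and ge: "\<And>w a b. w = a \<cdot>\<^sub>v f + b \<cdot>\<^sub>v g \<Longrightarrow> w \<bullet> (A *\<^sub>v w) \<ge> c * (w \<bullet> w)"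
  shows "lambda2 A \<ge> c"
proof -
  obtain P es where P: "P \<in> carrier_mat n n" and len: "length es = n"
    and ms: "mset (eigenvalues_desc A) = mset es"
    and norm: "\<And>w. w \<in> carrier_vec n \<Longrightarrow> w \<bullet> w = (\<Sum>i<n. ((P *\<^sub>v w) $ i)\<^sup>2)"
    and form: "\<And>w. w \<in> carrier_vec n \<Longrightarrow> w \<bullet> (A *\<^sub>v w) = (\<Sum>i<n. es ! i * ((P *\<^sub>v w) $ i)\<^sup>2)"
    by (rule symmetric_mat_spectral_coordinates[OF A sym]) (rule that)
  define I where "I = {i. i < n \<and> c \<le> es ! i}"
  have fin: "finite I" unfolding I_def by simp
  have "card I \<ge> 2"
  proof (rule ccontr)
    assume "\<not> card I \<ge> 2"
    then have "card I \<le> Suc 0" by simp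
    then have "\<forall>i\<in>I. \<forall>j\<in>I. i = j" using card_le_Suc0_iff_eq[OF fin] by simp
    \<comment> \<open>If \<open>I\<close> is empty, \<open>k\<close> is arbitrary and may even
      exceed the dimension; this is why \<open>k0\<close> below is conditional on
      \<open>k < n\<close>.\<close>
    then obtain k where k: "\<And>i. i \<in> I \<Longrightarrow> i = k" by (cases "I = {}") auto
    have lt: "es ! i < c" if "i < n" "i \<noteq> k" for i
    proof (rule ccontr)
      assume "\<not> es ! i < c"
      then have "i \<in> I" unfolding I_def using that by simp
      with k that show False by blast
    qed
    \<comment> \<open>The coefficients solve \<open>a * (P f)_k + b * (P g)_k = 0\<close>; the case
      split keeps them from both vanishing.\<close>
    define a where "a = (if (P *\<^sub>v f) $ k = 0 then 1 else - (P *\<^sub>v g) $ k)"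
    define b where "b = (if (P *\<^sub>v f) $ k = 0 then 0 else (P *\<^sub>v f) $ k)"
    define w where "w = a \<cdot>\<^sub>v f + b \<cdot>\<^sub>v g"
    have w: "w \<in> carrier_vec n" unfolding w_def using f g by simp
    have w0: "w \<noteq> 0\<^sub>v n" unfolding w_def by (rule indep) (auto simp: a_def b_def)
    have "(P *\<^sub>v w) $ i = a * (P *\<^sub>v f) $ i + b * (P *\<^sub>v g) $ i" if "i < n" for i
    proof -
      have "P *\<^sub>v w = a \<cdot>\<^sub>v (P *\<^sub>v f) + b \<cdot>\<^sub>v (P *\<^sub>v g)"
        unfolding w_def using P f g
        by (simp add: mult_add_distrib_mat_vec[of _ n n] mult_mat_vec[of _ n n])
      then show ?thesis using P that by simp
    qed
    then have k0: "(P *\<^sub>v w) $ k = 0" if "k < n"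
      using that by (simp add: a_def b_def)
    have pos: "w \<bullet> w > 0" using conjugate_square_greater_0_vec[OF w] w0 by simp
    have le: "es ! i * ((P *\<^sub>v w) $ i)\<^sup>2 \<le> c * ((P *\<^sub>v w) $ i)\<^sup>2" if "i < n" for i
    proof (cases "i = k")
      case True
      then show ?thesis using k0 that by simp
    next
      case False
      then have "es ! i < c" using lt that by simp
      then show ?thesis by (intro mult_right_mono) auto
    qed
    have "\<exists>i<n. (P *\<^sub>v w) $ i \<noteq> 0"
    proof (rule ccontr)
      assume "\<not> ?thesis"
      then have "w \<bullet> w = 0" unfolding norm[OF w] by simp
      with pos show False by simp
    qed
    then obtain i where i: "i < n" "(P *\<^sub>v w) $ i \<noteq> 0" by auto
    then have "i \<noteq> k" using k0 by auto
    then have "es ! i < c" using lt i by simp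
    then have "es ! i * ((P *\<^sub>v w) $ i)\<^sup>2 < c * ((P *\<^sub>v w) $ i)\<^sup>2" using i by simp
    then have "(\<Sum>i<n. es ! i * ((P *\<^sub>v w) $ i)\<^sup>2) < (\<Sum>i<n. c * ((P *\<^sub>v w) $ i)\<^sup>2)"
      using le i by (intro sum_strict_mono_ex1 bexI[of _ i]) auto
    then have "w \<bullet> (A *\<^sub>v w) < c * (w \<bullet> w)"
      unfolding form[OF w] norm[OF w] by (simp add: sum_distrib_left)
    with ge[OF w_def] show False by simp
  qed
  moreover have "card I = length (filter (\<lambda>x. c \<le> x) es)"
    unfolding I_def length_filter_conv_card len ..
  moreover have "\<dots> = length (filter (\<lambda>x. c \<le> x) (eigenvalues_desc A))"
    using ms by (metis mset_filter size_mset)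
  moreover have "sorted_wrt (\<ge>) (eigenvalues_desc A)"
    unfolding eigenvalues_desc_def by (simp add: sorted_wrt_rev)
  ultimately show ?thesis
    unfolding lambda2_def by (intro nth_1_ge_if_filter_ge) auto
qed

subsection \<open>Positive resolvent vectors\<close>

text \<open>A kernel vector would have form zero, so positivity makes the matrix injective and hence
  invertible.\<close>

lemma solve_if_form_positive:
  fixes M :: "nat \<Rightarrow> nat \<Rightarrow> real" and b :: "nat \<Rightarrow> real"
  assumes pos: "\<And>f. \<exists>i<n. f i \<noteq> 0 \<Longrightarrow> (\<Sum>i<n. f i * (\<Sum>j<n. M i j * f j)) > 0"
  shows "\<exists>g. \<forall>i<n. (\<Sum>j<n. M i j * g j) = b i"
proof -
  define A where "A = mat n n (\<lambda>(i, j). M i j)"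
  have A: "A \<in> carrier_mat n n" unfolding A_def by simp
  have Av: "(A *\<^sub>v v) $ i = (\<Sum>j<n. M i j * v $ j)" if "i < n" "v \<in> carrier_vec n" for v i
    using that unfolding A_def by (simp add: scalar_prod_def row_def lessThan_atLeast0)
  have "det A \<noteq> 0"
  proof
    assume "det A = 0"
    then obtain v where v: "v \<in> carrier_vec n" "v \<noteq> 0\<^sub>v n" and Av0: "A *\<^sub>v v = 0\<^sub>v n"
      using det_0_iff_vec_prod_zero[OF A] by auto
    have "\<exists>i<n. v $ i \<noteq> 0" using v by (auto simp: vec_eq_iff)
    then have "(\<Sum>i<n. v $ i * (\<Sum>j<n. M i j * v $ j)) > 0" by (rule pos)
    moreover have "(\<Sum>j<n. M i j * v $ j) = 0" if "i < n" for i
      using Av[OF that v(1)] that unfolding Av0 by simp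
    ultimately show False by simp
  qed
  then obtain B where B: "B \<in> carrier_mat n n" and AB: "A * B = 1\<^sub>m n"
    using det_non_zero_imp_unit[OF A, of undefined] unfolding Units_def
    by (auto simp: ring_mat_def)
  define g where "g = B *\<^sub>v vec n b"
  have g: "g \<in> carrier_vec n" unfolding g_def using B by simp
  have "A *\<^sub>v g = vec n b"
    unfolding g_def using A B AB by (simp add: assoc_mult_mat_vec[of _ n n _ n, symmetric])
  then have "(\<Sum>j<n. M i j * g $ j) = b i" if "i < n" for i
    using Av[OF that g] that by simp
  then show ?thesis by blast
qed

text \<open>Pairing the equation with the negative part of its solution shows that this part vanishes.\<close>

lemma positive_resolvent_vector:
  fixes K :: "nat \<Rightarrow> nat \<Rightarrow> real"
  assumes s: "s > 0" and K: "\<And>i j. K i j \<ge> 0"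
    and less: "\<And>f. \<exists>i<n. f i \<noteq> 0 \<Longrightarrow> (\<Sum>i<n. f i * (\<Sum>j<n. K i j * f j)) < s * (\<Sum>i<n. (f i)\<^sup>2)"
  shows "\<exists>g. \<forall>i<n. g i > 0 \<and> s * g i = 1 + (\<Sum>j<n. K i j * g j)"
proof -
  define M where "M = (\<lambda>i j. (if i = j then s else 0) - K i j)"
  have M: "(\<Sum>j<n. M i j * f j) = s * f i - (\<Sum>j<n. K i j * f j)" if "i < n" for i f
  proof -
    have "(\<Sum>j<n. M i j * f j) = (\<Sum>j<n. (if i = j then s * f j else 0) - K i j * f j)"
      unfolding M_def by (intro sum.cong) (auto simp: algebra_simps)
    then show ?thesis using that by (simp add: sum_subtractf)
  qed
  have form: "(\<Sum>i<n. f i * (\<Sum>j<n. M i j * f j)) =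
      s * (\<Sum>i<n. (f i)\<^sup>2) - (\<Sum>i<n. f i * (\<Sum>j<n. K i j * f j))" for f
  proof -
    have "(\<Sum>i<n. f i * (\<Sum>j<n. M i j * f j)) = (\<Sum>i<n. s * (f i)\<^sup>2 - f i * (\<Sum>j<n. K i j * f j))"
      by (intro sum.cong) (auto simp: M right_diff_distrib power2_eq_square)
    then show ?thesis by (simp add: sum_subtractf sum_distrib_left)
  qed
  have "\<exists>g. \<forall>i<n. (\<Sum>j<n. M i j * g j) = 1"
    by (rule solve_if_form_positive) (use less in \<open>simp add: form\<close>)
  then obtain g where "\<forall>i<n. (\<Sum>j<n. M i j * g j) = 1" by blast
  then have g: "s * g i = 1 + (\<Sum>j<n. K i j * g j)" if "i < n" for i
    using M[OF that, of g] that by simp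
  \<comment> \<open>The negative part of \<open>g\<close>; wherever it is nonzero it equals
    \<open>- g i\<close>, so its square is \<open>- p i * g i\<close>.\<close>
  define p where "p = (\<lambda>i. max (- g i) 0)"
  have p0: "p i \<ge> 0" and gp: "g i + p i \<ge> 0" for i unfolding p_def by auto
  have "p i = 0" if "i < n" for i
  proof (rule ccontr)
    assume "p i \<noteq> 0"
    then have "(\<Sum>i<n. p i * (\<Sum>j<n. K i j * p j)) < s * (\<Sum>i<n. (p i)\<^sup>2)"
      using less that by blast
    also have "\<dots> = (\<Sum>i<n. - (p i * (s * g i)))"
      unfolding sum_distrib_left by (intro sum.cong) (auto simp: p_def max_def power2_eq_square)
    \<comment> \<open>Substitute the equation for \<open>s * g i\<close> and split
      \<open>g = (g + p) - p\<close>. Here \<open>g + p\<close> is the positive part of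
      \<open>g\<close>, so both subtracted sums are nonnegative, and the chain bounds the form of
      \<open>p\<close> strictly by itself.\<close>
    also have "\<dots> = (\<Sum>i<n. p i * (\<Sum>j<n. K i j * p j)) - (\<Sum>i<n. p i)
        - (\<Sum>i<n. p i * (\<Sum>j<n. K i j * (g j + p j)))"
      unfolding sum_subtractf[symmetric]
      by (intro sum.cong) (auto simp: g sum.distrib algebra_simps)
    also have "\<dots> \<le> (\<Sum>i<n. p i * (\<Sum>j<n. K i j * p j))"
    proof -
      have "(\<Sum>i<n. p i) \<ge> 0" using p0 by (intro sum_nonneg) auto
      moreover have "(\<Sum>i<n. p i * (\<Sum>j<n. K i j * (g j + p j))) \<ge> 0"
        using p0 gp K by (intro sum_nonneg mult_nonneg_nonneg) auto
      ultimately show ?thesis by linarith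
    qed
    finally show False by simp
  qed
  then have g0: "g i \<ge> 0" if "i < n" for i using gp[of i] that by simp
  have "g i > 0" if "i < n" for i
  proof -
    have "(\<Sum>j<n. K i j * g j) \<ge> 0" using g0 K by (intro sum_nonneg) auto
    then have "s * g i > 0" using g[OF that] by simp
    then show ?thesis using s by (simp add: zero_less_mult_iff)
  qed
  then show ?thesis using g by blast
qed

text \<open>With \<open>j = l - a\<close> the index conditions become
  \<open>1 \<le> j \<le> n - r\<close> and \<open>0 \<le> a \<le> r\<close>, so for each
  \<open>j\<close> the full range of \<open>a\<close> occurs. The terms for \<open>a\<close> and
  \<open>r - a\<close> contain reciprocal quotients of \<open>h\<close>, which cancel in the
  geometric mean.\<close>

lemma sum_recurrence_AM_GM:
  fixes h d :: "nat \<Rightarrow> real"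
  assumes h: "\<And>l. l \<le> n \<Longrightarrow> h l > 0" and d: "\<And>i. d i \<ge> 0" and n: "1 \<le> n" and rn: "r \<le> n"
    and rec: "\<And>l. 1 \<le> l \<Longrightarrow> l \<le> n \<Longrightarrow>
      s * h l > (\<Sum>a | a \<le> r \<and> a < l \<and> l + r \<le> n + a. d (r - a) * h (l - a + (r - a)))"
  shows "s * real n > real (n - r) * (\<Sum>i = 0..r. sqrt (d i * d (r - i)))"
proof -
  define T where "T = (\<lambda>j. \<Sum>a = 0..r. d (r - a) * h (j + (r - a)) / h (j + a))"
  have T: "T j \<ge> (\<Sum>i = 0..r. sqrt (d i * d (r - i)))" if j: "j \<in> {1..n - r}" for j
  proof -
    \<comment> \<open>Reversing the order of summation lets \<open>T j\<close> be averaged with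
      itself, which pairs \<open>a\<close> with \<open>r - a\<close>.\<close>
    have "T j = (\<Sum>a = 0..r. d a * h (j + a) / h (j + (r - a)))"
      unfolding T_def by (subst sum.atLeastAtMost_rev) (auto intro!: sum.cong)
    then have "2 * T j = (\<Sum>a = 0..r. d (r - a) * h (j + (r - a)) / h (j + a)
        + d a * h (j + a) / h (j + (r - a)))"
      unfolding sum.distrib T_def by linarith
    also have "\<dots> \<ge> (\<Sum>a = 0..r. 2 * sqrt (d a * d (r - a)))"
    proof (rule sum_mono)
      fix a assume a: "a \<in> {0..r}"
      have pos: "h (j + (r - a)) > 0" "h (j + a) > 0" using a j rn by (auto intro!: h)
      let ?x = "d (r - a) * h (j + (r - a)) / h (j + a)" and ?y = "d a * h (j + a) / h (j + (r - a))"
      have "?x * ?y = d a * d (r - a)" using pos by (simp add: field_simps)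
      moreover have "?x \<ge> 0" "?y \<ge> 0" using pos d by (simp_all add: less_imp_le)
      ultimately show "2 * sqrt (d a * d (r - a)) \<le> ?x + ?y"
        using arith_geo_mean_sqrt[of ?x ?y] by simp
    qed
    finally show ?thesis by (simp add: sum_distrib_left[symmetric])
  qed
  have "real (n - r) * (\<Sum>i = 0..r. sqrt (d i * d (r - i))) \<le> (\<Sum>j\<in>{1..n - r}. T j)"
    using sum_mono[of "{1..n - r}" "\<lambda>_. \<Sum>i = 0..r. sqrt (d i * d (r - i))" T] T by simp
  also have "\<dots> = (\<Sum>(j, a) \<in> {1..n - r} \<times> {0..r}. d (r - a) * h (j + (r - a)) / h (j + a))"
    unfolding T_def by (rule sum.cartesian_product)
  also have "\<dots> = (\<Sum>(l, a) \<in> (SIGMA l:{1..n}. {a. a \<le> r \<and> a < l \<and> l + r \<le> n + a}).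
      d (r - a) * h (l - a + (r - a)) / h l)"
    by (rule sum.reindex_bij_witness[of _ "\<lambda>(l, a). (l - a, a)" "\<lambda>(j, a). (j + a, a)"])
      (use rn in auto)
  also have "\<dots> = (\<Sum>l = 1..n. (\<Sum>a | a \<le> r \<and> a < l \<and> l + r \<le> n + a.
      d (r - a) * h (l - a + (r - a))) / h l)"
    by (subst sum.Sigma[symmetric]) (auto simp: sum_divide_distrib)
  also have "\<dots> < (\<Sum>l = 1..n. s)"
    using n h rec by (intro sum_strict_mono) (auto simp: pos_divide_less_eq)
  finally show ?thesis by (simp add: mult.commute)
qed

subsection \<open>Walks and distances\<close>

lemma walk_trans: "walk E x y k \<Longrightarrow> walk E y z l \<Longrightarrow> walk E x z (k + l)"
  by (induction rule: walk.induct) (auto intro: walk.intros)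

lemma walk_edge: "E x y \<Longrightarrow> walk E x y 1"
  using walk.walk_step[OF _ walk.walk_refl] by simp

lemma gdist_le_walk: "walk E x y k \<Longrightarrow> gdist E x y \<le> k"
  unfolding gdist_def by (rule Least_le)

lemma gdist_same [simp]: "gdist E x x = 0"
  using gdist_le_walk[OF walk.walk_refl] by simp

lemma walk_sequence:
  assumes "walk E x y k"
  shows "\<exists>q. q 0 = x \<and> q k = y \<and> (\<forall>i<k. E (q i) (q (Suc i)))"
  using assms
proof (induction rule: walk.induct)
  case (walk_refl x)
  then show ?case by auto
next
  case (walk_step x z y k)
  then obtain q where "q 0 = z" "q k = y" "\<forall>i<k. E (q i) (q (Suc i))" by blast
  with walk_step.hyps(1) show ?case
    by (intro exI[of _ "case_nat x q"]) (auto split: nat.split)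
qed

lemma walk_segment:
  assumes q: "\<forall>i<k. E (q i) (q (Suc i))" and "i \<le> j" "j \<le> k"
  shows "walk E (q i) (q j) (j - i)"
  using assms(2,3)
proof (induction rule: dec_induct)
  case base
  then show ?case by (simp add: walk.walk_refl)
next
  case (step j)
  then have "walk E (q i) (q (Suc j)) (j - i + 1)"
    using q by (intro walk_trans[OF _ walk_edge]) auto
  then show ?case using step.hyps by (simp add: Suc_diff_le)
qed

locale finite_connected_graph =
  fixes N :: nat and E :: "nat \<Rightarrow> nat \<Rightarrow> bool"
  assumes graph: "is_graph N E" and conn: "connected_graph N E"
begin

lemma edgeD: "E x y \<Longrightarrow> x < N \<and> y < N \<and> E y x"
  using graph unfolding is_graph_def by blast

lemma walk_less: "walk E x y k \<Longrightarrow> x < N \<Longrightarrow> y < N"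
  by (induction rule: walk.induct) (auto dest: edgeD)

lemma walk_sym: "walk E x y k \<Longrightarrow> walk E y x k"
proof (induction rule: walk.induct)
  case (walk_step x z y k)
  then have "walk E z x 1" using edgeD walk_edge by blast
  then show ?case using walk_trans[OF walk_step.IH, of x 1] by simp
qed (rule walk.walk_refl)

lemma gdist_sym: "gdist E x y = gdist E y x"
proof -
  have "walk E x y = walk E y x" by (auto intro: walk_sym)
  then show ?thesis unfolding gdist_def by simp
qed

lemma walk_gdist: "x < N \<Longrightarrow> y < N \<Longrightarrow> walk E x y (gdist E x y)"
  using conn unfolding connected_graph_def gdist_def by (blast intro: LeastI_ex)

lemma gdist_triangle:
  assumes "x < N" "y < N" "z < N"
  shows "gdist E x z \<le> gdist E x y + gdist E y z"
  using assms by (blast intro: gdist_le_walk walk_trans walk_gdist)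

lemma gdist_walk_triangle:
  assumes "walk E x y k" "x < N" "z < N"
  shows "gdist E x z \<le> k + gdist E y z"
  using gdist_triangle[of x y z] gdist_le_walk[OF assms(1)] walk_less[OF assms(1,2)] assms by simp

lemma delta_le_card:
  assumes "E x y"
  shows "delta N E i \<le> card {v. v < N \<and> gdist E x v = i \<and> gdist E y v \<ge> i}"
proof -
  let ?f = "\<lambda>(x, y). card {v. v < N \<and> gdist E x v = i \<and> gdist E y v \<ge> i}"
  have "{card {v. v < N \<and> gdist E x v = i \<and> gdist E y v \<ge> i} | x y. E x y}
      \<subseteq> ?f ` ({..<N} \<times> {..<N})"
    by (auto dest: edgeD)
  then have "finite {card {v. v < N \<and> gdist E x v = i \<and> gdist E y v \<ge> i} | x y. E x y}"
    by (rule finite_subset) simp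
  then show ?thesis unfolding delta_def using assms by (intro Min_le) auto
qed

text \<open>Walks may backtrack, and every vertex has a neighbour by connectedness. This keeps the
  minima over endpoints of walks of a given length well defined, even for lengths beyond the
  eccentricity of \<open>x\<close>.\<close>

lemma walk_of_length:
  assumes N: "N \<ge> 2" and x: "x < N"
  shows "\<exists>y. walk E x y l"
proof (induction l)
  case (Suc l)
  then obtain y where y: "walk E x y l" by blast
  have yN: "y < N" by (rule walk_less[OF y x])
  obtain z where z: "z < N" "z \<noteq> y"
    using N by (cases "y = 0") (auto intro: that[of 1] that[of 0])
  obtain k where "walk E y z k" using conn yN z unfolding connected_graph_def by blast
  then obtain z' where "E y z'" using z by (cases rule: walk.cases) auto
  then show ?case using walk_trans[OF y walk_edge] by auto
qed (auto intro: walk.walk_refl)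

text \<open>Along a walk of length \<open>l\<close> ending in \<open>u\<close>, the \<open>a\<close>-th edge from the end contributes the
  vertices at distance \<open>r - a\<close> from its later endpoint and no closer to its earlier one.
  These sets are disjoint for different \<open>a\<close> and lie in the ball of radius \<open>r\<close> around \<open>u\<close>, and
  their vertices are reached from \<open>x\<close> by walks of length \<open>(l - a) + (r - a)\<close>.\<close>

lemma sum_ball_ge_sum_along_walk:
  fixes g :: "nat \<Rightarrow> real" and h :: "nat \<Rightarrow> real"
  assumes x: "x < N" and walk: "walk E x u l"
    and g: "\<And>v. v < N \<Longrightarrow> g v \<ge> 0"
    and h: "\<And>v k. walk E x v k \<Longrightarrow> k \<le> n \<Longrightarrow> h k \<le> g v"
    and h0: "\<And>k. k \<le> n \<Longrightarrow> h k \<ge> 0"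
  shows "(\<Sum>a | a \<le> r \<and> a < l \<and> l + r \<le> n + a. real (delta N E (r - a)) * h (l - a + (r - a)))
    \<le> (\<Sum>v | v < N \<and> gdist E x v \<le> n \<and> gdist E u v \<le> r. g v)"
proof -
  obtain q where q0: "q 0 = x" and ql: "q l = u" and q: "\<forall>i<l. E (q i) (q (Suc i))"
    using walk_sequence[OF walk] by blast
  have segment: "walk E (q i) (q j) (j - i)" if "i \<le> j" "j \<le> l" for i j
    using walk_segment[where E = E and q = q, OF q that] .
  have qN: "q i < N" if "i \<le> l" for i
    using walk_less[OF segment[of 0 i]] that x q0 by simp
  define I where "I = {a. a \<le> r \<and> a < l \<and> l + r \<le> n + a}"
  define V where "V = (\<lambda>a. {v. v < N \<and> gdist E (q (l - a)) v = r - a \<and> gdist E (q (l - Suc a)) v \<ge> r - a})"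
  have finI: "finite I" unfolding I_def by simp
  have finV: "finite (V a)" for a unfolding V_def by simp
  have cardV: "delta N E (r - a) \<le> card (V a)" if "a \<in> I" for a
  proof -
    have "Suc (l - Suc a) = l - a" using that unfolding I_def by auto
    then have "E (q (l - Suc a)) (q (l - a))" using q[rule_format, of "l - Suc a"] by auto
    \<comment> \<open>The edge is used in reverse orientation: its later endpoint plays the first
      role in \<open>delta\<close>.\<close>
    then show ?thesis unfolding V_def by (intro delta_le_card) (simp add: edgeD)
  qed
  have walkV: "walk E x v (l - a + (r - a))" if "a \<in> I" "v \<in> V a" for a v
  proof -
    have "walk E (q 0) (q (l - a)) (l - a - 0)" by (rule segment) auto
    moreover have "walk E (q (l - a)) v (r - a)"
      using walk_gdist[of "q (l - a)" v] qN[of "l - a"] that unfolding V_def by auto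
    ultimately show ?thesis unfolding q0 by (auto intro: walk_trans)
  qed
  have lenV: "l - a + (r - a) \<le> n" if "a \<in> I" for a using that unfolding I_def by auto
  have disj: "V a \<inter> V b = {}" if "a \<in> I" "b \<in> I" "a < b" for a b
  proof -
    \<comment> \<open>From \<open>q (l - Suc a)\<close> one walks back \<open>b - a - 1\<close>
      steps to \<open>q (l - b)\<close> and then \<open>r - b\<close> steps to \<open>v\<close>. The
      total is \<open>r - a - 1\<close>, too short for \<open>v\<close> to lie in
      \<open>V a\<close>.\<close>
    have "gdist E (q (l - Suc a)) v < r - a" if v: "v \<in> V b" for v
    proof -
      have "walk E (q (l - b)) (q (l - Suc a)) (l - Suc a - (l - b))"
        by (rule segment) (use \<open>a < b\<close> in auto)
      then have "gdist E (q (l - Suc a)) v \<le> l - Suc a - (l - b) + gdist E (q (l - b)) v"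
        using qN[of "l - Suc a"] v by (intro gdist_walk_triangle[OF walk_sym]) (auto simp: V_def)
      also have "\<dots> < r - a" using v \<open>a < b\<close> \<open>b \<in> I\<close> unfolding V_def I_def by auto
      finally show ?thesis .
    qed
    then show ?thesis unfolding V_def by fastforce
  qed
  have "(\<Sum>a\<in>I. real (delta N E (r - a)) * h (l - a + (r - a))) \<le> (\<Sum>a\<in>I. \<Sum>v\<in>V a. g v)"
  proof (rule sum_mono)
    fix a assume a: "a \<in> I"
    have "real (delta N E (r - a)) * h (l - a + (r - a)) \<le> real (card (V a)) * h (l - a + (r - a))"
      using cardV[OF a] h0[OF lenV[OF a]] by (intro mult_right_mono) auto
    also have "\<dots> = (\<Sum>v\<in>V a. h (l - a + (r - a)))" by simp
    also have "\<dots> \<le> (\<Sum>v\<in>V a. g v)"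
      using walkV[OF a] lenV[OF a] by (intro sum_mono h) auto
    finally show "real (delta N E (r - a)) * h (l - a + (r - a)) \<le> (\<Sum>v\<in>V a. g v)" .
  qed
  also have "\<dots> = (\<Sum>v\<in>(\<Union>a\<in>I. V a). g v)"
  proof (rule sum.UNION_disjoint[symmetric])
    show "\<forall>a\<in>I. \<forall>b\<in>I. a \<noteq> b \<longrightarrow> V a \<inter> V b = {}"
      using disj by (metis inf_commute nat_neq_iff)
  qed (use finI finV in auto)
  also have "\<dots> \<le> (\<Sum>v | v < N \<and> gdist E x v \<le> n \<and> gdist E u v \<le> r. g v)"
  proof (rule sum_mono2)
    show "(\<Union>a\<in>I. V a) \<subseteq> {v. v < N \<and> gdist E x v \<le> n \<and> gdist E u v \<le> r}"
    proof safe
      fix a v assume a: "a \<in> I" and v: "v \<in> V a"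
      show "v < N" using v unfolding V_def by simp
      show "gdist E x v \<le> n" using gdist_le_walk[OF walkV[OF a v]] lenV[OF a] by simp
      have "walk E (q (l - a)) (q l) (l - (l - a))" by (rule segment) auto
      then have "gdist E u v \<le> l - (l - a) + gdist E (q (l - a)) v"
        using qN[of l] v unfolding ql by (intro gdist_walk_triangle[OF walk_sym]) (auto simp: V_def)
      also have "\<dots> \<le> r" using a v unfolding I_def V_def by auto
      finally show "gdist E u v \<le> r" .
    qed
  qed (use g in auto)
  finally show ?thesis unfolding I_def .
qed

subsection \<open>Test functions on balls\<close>

lemma ball_test_function:
  assumes N: "N \<ge> 2" and x: "x < N" and n: "1 \<le> n" and rn: "r \<le> n" and s: "s > 0"
    and s_le: "s * real n \<le> real (n - r) *
      (\<Sum>i = 0..r. sqrt (real (delta N E i) * real (delta N E (r - i))))"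
  shows "\<exists>f :: nat \<Rightarrow> real. (\<exists>i<N. f i \<noteq> 0) \<and> (\<forall>i. f i \<noteq> 0 \<longrightarrow> gdist E x i \<le> n) \<and>
    (\<Sum>i<N. f i * (\<Sum>j<N. (if gdist E i j \<le> r then 1 else 0) * f j)) \<ge> s * (\<Sum>i<N. (f i)\<^sup>2)"
proof (rule ccontr)
  define A where "A = (\<lambda>i j. if gdist E i j \<le> r then 1 else 0 :: real)"
  assume "\<not> ?thesis"
  then have neg: "(\<Sum>i<N. f i * (\<Sum>j<N. A i j * f j)) < s * (\<Sum>i<N. (f i)\<^sup>2)"
    if "\<exists>i<N. f i \<noteq> 0" "\<And>i. f i \<noteq> 0 \<Longrightarrow> gdist E x i \<le> n" for f
    using that unfolding A_def by (meson not_le)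
  define B where "B = {v. gdist E x v \<le> n}"
  \<comment> \<open>The restriction to the ball is extended by zero to all vertices, so no
    reindexing is required. Entries of \<open>f\<close> outside the ball add nothing to the form of
    \<open>K\<close> but only enlarge the squared norm; if \<open>f\<close> vanishes on the ball,
    the form is zero and the bound is still strict.\<close>
  define K where "K = (\<lambda>i j. if i \<in> B \<and> j \<in> B \<and> gdist E i j \<le> r then 1 else 0 :: real)"
  have "(\<Sum>i<N. f i * (\<Sum>j<N. K i j * f j)) < s * (\<Sum>i<N. (f i)\<^sup>2)"
    if f: "\<exists>i<N. f i \<noteq> 0" for f
  proof -
    define f' where "f' = (\<lambda>i. if i \<in> B then f i else 0)"
    have inner: "f i * (\<Sum>j<N. K i j * f j) = f' i * (\<Sum>j<N. A i j * f' j)" for i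
    proof (cases "i \<in> B")
      case True
      then have "(\<Sum>j<N. K i j * f j) = (\<Sum>j<N. A i j * f' j)"
        unfolding K_def A_def f'_def by (intro sum.cong) auto
      then show ?thesis using True unfolding f'_def by simp
    qed (simp add: K_def f'_def)
    have le: "(\<Sum>i<N. (f' i)\<^sup>2) \<le> (\<Sum>i<N. (f i)\<^sup>2)"
      by (intro sum_mono) (auto simp: f'_def)
    show ?thesis
    proof (cases "\<exists>i<N. f' i \<noteq> 0")
      case True
      then have "(\<Sum>i<N. f' i * (\<Sum>j<N. A i j * f' j)) < s * (\<Sum>i<N. (f' i)\<^sup>2)"
        by (rule neg) (auto simp: f'_def B_def split: if_splits)
      also have "\<dots> \<le> s * (\<Sum>i<N. (f i)\<^sup>2)" using le s by simp
      finally show ?thesis unfolding inner .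
    next
      case False
      then have "(\<Sum>i<N. f' i * (\<Sum>j<N. A i j * f' j)) = 0" by (intro sum.neutral) auto
      moreover have "(\<Sum>i<N. (f i)\<^sup>2) > 0"
      proof -
        obtain i where "i < N" "f i \<noteq> 0" using f by blast
        then show ?thesis by (intro sum_pos2[of _ i]) auto
      qed
      ultimately show ?thesis unfolding inner using s by simp
    qed
  qed
  then have "\<exists>g. \<forall>i<N. g i > 0 \<and> s * g i = 1 + (\<Sum>j<N. K i j * g j)"
    by (intro positive_resolvent_vector s) (simp_all add: K_def)
  then obtain g where g0: "\<And>i. i < N \<Longrightarrow> g i > 0"
    and g: "\<And>i. i < N \<Longrightarrow> s * g i = 1 + (\<Sum>j<N. K i j * g j)" by blast
  \<comment> \<open>Endpoints are sorted by walk length, not by distance: a vertex found through a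
    walk of length \<open>k\<close> is then bounded below by \<open>h k\<close> directly, even if it
    lies closer to \<open>x\<close>.\<close>
  define W where "W = (\<lambda>l. {v. walk E x v l})"
  define h where "h = (\<lambda>l. Min (g ` W l))"
  have W_less: "v < N" if "v \<in> W l" for v l using that walk_less x unfolding W_def by blast
  have fin: "finite (W l)" for l
    by (rule finite_subset[of _ "{..<N}"]) (auto dest: W_less)
  have ne: "W l \<noteq> {}" for l using walk_of_length[OF N x] unfolding W_def by auto
  have "h l \<in> g ` W l" for l unfolding h_def using fin ne by (intro Min_in) auto
  then have h_min: "\<exists>u\<in>W l. h l = g u" for l by blast
  have h0: "h l > 0" for l using h_min[of l] g0 W_less by auto
  have h_le: "h k \<le> g v" if "walk E x v k" for v k
    using that fin unfolding h_def W_def by (intro Min_le) auto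
  have "s * h l > (\<Sum>a | a \<le> r \<and> a < l \<and> l + r \<le> n + a.
      real (delta N E (r - a)) * h (l - a + (r - a)))" if l: "l \<le> n" for l
  proof -
    obtain u where u: "u \<in> W l" and hu: "h l = g u" using h_min by blast
    have walk: "walk E x u l" using u unfolding W_def by simp
    \<comment> \<open>Since \<open>l \<le> n\<close>, the minimiser lies in the ball, so its row of
      \<open>K\<close> is the indicator of all ball vertices within distance \<open>r\<close>. The
      summand 1 in the equation for \<open>g\<close> makes the final inequality strict.\<close>
    have uB: "u \<in> B" using gdist_le_walk[OF walk] l unfolding B_def by simp
    have uN: "u < N" by (rule W_less[OF u])
    have "(\<Sum>a | a \<le> r \<and> a < l \<and> l + r \<le> n + a. real (delta N E (r - a)) * h (l - a + (r - a)))
      \<le> (\<Sum>v | v < N \<and> gdist E x v \<le> n \<and> gdist E u v \<le> r. g v)"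
      by (rule sum_ball_ge_sum_along_walk[OF x walk])
        (use g0 h0 h_le in \<open>auto simp: less_imp_le\<close>)
    also have "{v. v < N \<and> gdist E x v \<le> n \<and> gdist E u v \<le> r}
        = {v \<in> {..<N}. v \<in> B \<and> gdist E u v \<le> r}"
      unfolding B_def by auto
    also have "(\<Sum>v\<in>{v \<in> {..<N}. v \<in> B \<and> gdist E u v \<le> r}. g v) = (\<Sum>j<N. K u j * g j)"
      unfolding K_def using uB by (subst sum.inter_filter) (auto intro!: sum.cong)
    also have "\<dots> < s * h l" unfolding hu g[OF uN] by simp
    finally show ?thesis .
  qed
  then have "s * real n > real (n - r) *
      (\<Sum>i = 0..r. sqrt (real (delta N E i) * real (delta N E (r - i))))"
    by (intro sum_recurrence_AM_GM[of n h] h0 n rn) auto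
  with s_le show False by simp
qed

section \<open>Quadratic forms of graph powers and their second eigenvalue\<close>

lemma power_adj_carrier: "power_adj N E r \<in> carrier_mat N N"
  unfolding power_adj_def by simp

lemma power_adj_symmetric: "transpose_mat (power_adj N E r) = power_adj N E r"
  unfolding power_adj_def by (intro eq_matI) (auto simp: gdist_sym)

lemma power_adj_form:
  assumes "w \<in> carrier_vec N"
  shows "w \<bullet> (power_adj N E r *\<^sub>v w) =
    (\<Sum>i<N. w $ i * (\<Sum>j<N. (if gdist E i j \<le> r then 1 else 0) * w $ j))"
  using assms unfolding power_adj_def
  by (auto simp: scalar_prod_def row_def lessThan_atLeast0 intro!: sum.cong)

text \<open>On the plane of the first two coordinates the form is \<open>(a + b)\<^sup>2\<close> or
  \<open>a\<^sup>2 + b\<^sup>2\<close>. This settles the final bound whenever its right-hand side is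
  not positive.\<close>

lemma lambda2_power_adj_nonneg:
  assumes N: "N \<ge> 2"
  shows "lambda2 (power_adj N E r) \<ge> 0"
proof (rule lambda2_ge_if_form_ge_on_plane[OF power_adj_carrier power_adj_symmetric,
      of "unit_vec N 0" "unit_vec N 1"])
  fix a b :: real assume ab: "a \<noteq> 0 \<or> b \<noteq> 0"
  let ?w = "a \<cdot>\<^sub>v unit_vec N 0 + b \<cdot>\<^sub>v unit_vec N 1"
  show "?w \<noteq> 0\<^sub>v N"
  proof
    assume eq: "?w = 0\<^sub>v N"
    have "?w $ 0 = a" "?w $ 1 = b" using N by (auto simp: unit_vec_def)
    then show False unfolding eq using ab N by simp
  qed
next
  fix w and a b :: real assume w: "w = a \<cdot>\<^sub>v unit_vec N 0 + b \<cdot>\<^sub>v unit_vec N 1"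
  define t :: real where "t = (if gdist E 0 1 \<le> r then 1 else 0)"
  have wi: "w $ 0 = a" "w $ 1 = b" and w0: "\<And>i. i < N \<Longrightarrow> 2 \<le> i \<Longrightarrow> w $ i = 0"
    using N unfolding w by (auto simp: unit_vec_def)
  have wN: "w \<in> carrier_vec N" unfolding w by simp
  have red: "(\<Sum>i<N. F i) = F 0 + F 1" if "\<And>i. i < N \<Longrightarrow> 2 \<le> i \<Longrightarrow> F i = 0" for F :: "nat \<Rightarrow> real"
  proof -
    have "(\<Sum>i<N. F i) = (\<Sum>i<2. F i)"
      using N that by (intro sum.mono_neutral_right) auto
    then show ?thesis by (simp add: numeral_2_eq_2)
  qed
  have "w \<bullet> (power_adj N E r *\<^sub>v w) = a * (a + t * b) + b * (t * a + b)"
    unfolding power_adj_form[OF wN] using w0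
    by (simp add: red wi[simplified] t_def gdist_sym[of "Suc 0" 0])
  also have "\<dots> \<ge> 0"
  proof -
    have "a * (a + t * b) + b * (t * a + b) = (if gdist E 0 1 \<le> r then (a + b)\<^sup>2 else a\<^sup>2 + b\<^sup>2)"
      unfolding t_def by (simp add: power2_eq_square algebra_simps)
    then show ?thesis by simp
  qed
  finally show "w \<bullet> (power_adj N E r *\<^sub>v w) \<ge> 0 * (w \<bullet> w)" by simp
qed auto

text \<open>No entry of the matrix joins the two supports, so on the spanned plane both the form and
  the squared norm split into an \<open>a\<^sup>2\<close> part and a \<open>b\<^sup>2\<close>
  part.\<close>

lemma lambda2_power_adj_ge_if_far_apart:
  fixes \<phi> \<psi> :: "nat \<Rightarrow> real"
  assumes nz: "\<exists>i<N. \<phi> i \<noteq> 0" "\<exists>i<N. \<psi> i \<noteq> 0"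
    and far: "\<And>i j. i < N \<Longrightarrow> j < N \<Longrightarrow> \<phi> i \<noteq> 0 \<Longrightarrow> \<psi> j \<noteq> 0 \<Longrightarrow> gdist E i j > r"
    and form_\<phi>: "(\<Sum>i<N. \<phi> i * (\<Sum>j<N. (if gdist E i j \<le> r then 1 else 0) * \<phi> j)) \<ge> s * (\<Sum>i<N. (\<phi> i)\<^sup>2)"
    and form_\<psi>: "(\<Sum>i<N. \<psi> i * (\<Sum>j<N. (if gdist E i j \<le> r then 1 else 0) * \<psi> j)) \<ge> s * (\<Sum>i<N. (\<psi> i)\<^sup>2)"
  shows "lambda2 (power_adj N E r) \<ge> s"
proof (rule lambda2_ge_if_form_ge_on_plane[OF power_adj_carrier power_adj_symmetric,
      of "vec N \<phi>" "vec N \<psi>"])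
  \<comment> \<open>A common support vertex would be at distance 0 from itself, contradicting
    \<open>far\<close>.\<close>
  have disj: "\<phi> i = 0 \<or> \<psi> i = 0" if "i < N" for i using far[of i i] that by auto
  {
    fix a b :: real assume ab: "a \<noteq> 0 \<or> b \<noteq> 0"
    obtain i j where i: "i < N" "\<phi> i \<noteq> 0" and j: "j < N" "\<psi> j \<noteq> 0" using nz by blast
    let ?w = "a \<cdot>\<^sub>v vec N \<phi> + b \<cdot>\<^sub>v vec N \<psi>"
    have "?w $ i = a * \<phi> i" "?w $ j = b * \<psi> j" using i j disj by auto
    then have "?w $ i \<noteq> 0 \<or> ?w $ j \<noteq> 0" using i j ab by auto
    then show "?w \<noteq> 0\<^sub>v N" using i j by (metis index_zero_vec(1))
  next
    fix w and a b :: real assume w: "w = a \<cdot>\<^sub>v vec N \<phi> + b \<cdot>\<^sub>v vec N \<psi>"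
    define A where "A = (\<lambda>i j. if gdist E i j \<le> r then 1 else 0 :: real)"
    have wN: "w \<in> carrier_vec N" unfolding w by simp
    have wi: "w $ i = a * \<phi> i + b * \<psi> i" if "i < N" for i using that unfolding w by simp
    have far': "\<phi> i = 0 \<or> \<psi> j = 0 \<or> r < gdist E i j" if "i < N" "j < N" for i j
      using far that by blast
    have cross: "A i j * (\<phi> i * \<psi> j) = 0" "A i j * (\<psi> i * \<phi> j) = 0" if "i < N" "j < N" for i j
      using far'[OF that] far'[OF that(2,1)] unfolding A_def by (auto simp: gdist_sym)
    have "w \<bullet> w = (\<Sum>i<N. (w $ i)\<^sup>2)"
      using wN by (simp add: scalar_prod_def lessThan_atLeast0 power2_eq_square)
    also have "\<dots> = (\<Sum>i<N. a\<^sup>2 * (\<phi> i)\<^sup>2 + b\<^sup>2 * (\<psi> i)\<^sup>2)"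
      using disj by (intro sum.cong) (auto simp: wi power2_eq_square algebra_simps)
    finally have norm: "w \<bullet> w = a\<^sup>2 * (\<Sum>i<N. (\<phi> i)\<^sup>2) + b\<^sup>2 * (\<Sum>i<N. (\<psi> i)\<^sup>2)"
      by (simp add: sum.distrib sum_distrib_left)
    have "w \<bullet> (power_adj N E r *\<^sub>v w) = (\<Sum>i<N. \<Sum>j<N. w $ i * (A i j * w $ j))"
      unfolding power_adj_form[OF wN] A_def sum_distrib_left ..
    also have "\<dots> = (\<Sum>i<N. \<Sum>j<N. a\<^sup>2 * (\<phi> i * (A i j * \<phi> j)) + b\<^sup>2 * (\<psi> i * (A i j * \<psi> j)))"
    proof (intro sum.cong refl)
      fix i j assume "i \<in> {..<N}" "j \<in> {..<N}"
      then have ij: "i < N" "j < N" by auto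
      have "w $ i * (A i j * w $ j) = a\<^sup>2 * (\<phi> i * (A i j * \<phi> j)) + b\<^sup>2 * (\<psi> i * (A i j * \<psi> j))
          + a * b * (A i j * (\<phi> i * \<psi> j)) + a * b * (A i j * (\<psi> i * \<phi> j))"
        unfolding wi[OF ij(1)] wi[OF ij(2)] by (simp add: power2_eq_square algebra_simps)
      then show "w $ i * (A i j * w $ j) =
          a\<^sup>2 * (\<phi> i * (A i j * \<phi> j)) + b\<^sup>2 * (\<psi> i * (A i j * \<psi> j))"
        unfolding cross[OF ij] by simp
    qed
    also have "\<dots> = a\<^sup>2 * (\<Sum>i<N. \<phi> i * (\<Sum>j<N. A i j * \<phi> j)) + b\<^sup>2 * (\<Sum>i<N. \<psi> i * (\<Sum>j<N. A i j * \<psi> j))"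
      by (simp add: sum.distrib sum_distrib_left)
    also have "\<dots> \<ge> a\<^sup>2 * (s * (\<Sum>i<N. (\<phi> i)\<^sup>2)) + b\<^sup>2 * (s * (\<Sum>i<N. (\<psi> i)\<^sup>2))"
      using form_\<phi> form_\<psi> unfolding A_def by (intro add_mono mult_left_mono) auto
    finally show "w \<bullet> (power_adj N E r *\<^sub>v w) \<ge> s * (w \<bullet> w)"
      unfolding norm by (simp add: algebra_simps)
  }
qed auto

section \<open>From the diameter to the eigenvalue bound\<close>

lemma diam_attained: "\<exists>x y. x < N \<and> y < N \<and> gdist E x y = diam N E"
proof -
  have "{gdist E x y | x y. x < N \<and> y < N} = (\<lambda>(x, y). gdist E x y) ` ({..<N} \<times> {..<N})" by auto
  then have "finite {gdist E x y | x y. x < N \<and> y < N}" by simp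
  moreover have "0 < N" using graph unfolding is_graph_def by simp
  then have "{gdist E x y | x y. x < N \<and> y < N} \<noteq> {}" by blast
  ultimately have "diam N E \<in> {gdist E x y | x y. x < N \<and> y < N}"
    unfolding diam_def by (rule Max_in)
  then obtain x y where "diam N E = gdist E x y" "x < N" "y < N" by blast
  then show ?thesis by metis
qed

lemma card_ge_2_if_diam_pos:
  assumes "diam N E > 0"
  shows "N \<ge> 2"
proof (rule ccontr)
  assume "\<not> N \<ge> 2"
  then have "x = 0" if "x < N" for x using that by simp
  then have "x = y" if "x < N" "y < N" for x y using that by metis
  then have "diam N E = 0" using diam_attained gdist_same by metis
  with assms show False by simp
qed

lemma lambda2_power_adj_ge:
  assumes diam: "2 * n + r < diam N E" and n: "1 \<le> n" and rn: "r \<le> n" and s: "s > 0"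
    and s_le: "s * real n \<le> real (n - r) *
      (\<Sum>i = 0..r. sqrt (real (delta N E i) * real (delta N E (r - i))))"
  shows "lambda2 (power_adj N E r) \<ge> s"
proof -
  obtain x y where x: "x < N" and y: "y < N" and xy: "gdist E x y = diam N E"
    using diam_attained by blast
  have N: "N \<ge> 2" using diam by (intro card_ge_2_if_diam_pos) simp
  obtain \<phi> where \<phi>: "\<exists>i<N. \<phi> i \<noteq> 0" "\<And>i. \<phi> i \<noteq> 0 \<Longrightarrow> gdist E x i \<le> n"
    "(\<Sum>i<N. \<phi> i * (\<Sum>j<N. (if gdist E i j \<le> r then 1 else 0) * \<phi> j)) \<ge> s * (\<Sum>i<N. (\<phi> i)\<^sup>2)"
    using ball_test_function[OF N x n rn s s_le] by blast
  obtain \<psi> where \<psi>: "\<exists>i<N. \<psi> i \<noteq> 0" "\<And>i. \<psi> i \<noteq> 0 \<Longrightarrow> gdist E y i \<le> n"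
    "(\<Sum>i<N. \<psi> i * (\<Sum>j<N. (if gdist E i j \<le> r then 1 else 0) * \<psi> j)) \<ge> s * (\<Sum>i<N. (\<psi> i)\<^sup>2)"
    using ball_test_function[OF N y n rn s s_le] by blast
  \<comment> \<open>Going from \<open>x\<close> to \<open>y\<close> through \<open>i\<close> and
    \<open>j\<close> costs at most \<open>2 * n\<close> outside the middle stretch, while the
    diameter exceeds \<open>2 * n + r\<close>.\<close>
  have "gdist E i j > r" if "i < N" "j < N" "\<phi> i \<noteq> 0" "\<psi> j \<noteq> 0" for i j
  proof -
    have "gdist E x y \<le> gdist E x i + gdist E i y" using x y that by (intro gdist_triangle) auto
    also have "gdist E i y \<le> gdist E i j + gdist E j y" using y that by (intro gdist_triangle) auto
    finally show ?thesis using \<phi>(2)[OF that(3)] \<psi>(2)[OF that(4)] xy diam gdist_sym[of j y] by simp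
  qed
  then show ?thesis
    by (intro lambda2_power_adj_ge_if_far_apart[of \<phi> \<psi>] \<phi>(1,3) \<psi>(1,3)) auto
qed

lemma lambda2_power_adj_ge_dhat:
  assumes \<epsilon>: "\<epsilon> > 0" and r: "r \<ge> 1" "real r \<le> \<epsilon> * real (diam N E)" and diam: "diam N E \<ge> 8"
  shows "lambda2 (power_adj N E r) \<ge>
    (1 - 4 * \<epsilon>) * real (r + 1) * dhat N E r powr (real r / 2)"
proof -
  define D where "D = diam N E"
  define c where "c = (\<Sum>i = 0..r. sqrt (real (delta N E i) * real (delta N E (r - i))))"
  have c0: "c \<ge> 0" unfolding c_def by (intro sum_nonneg) auto
  \<comment> \<open>The exponents \<open>2 / r\<close> and \<open>r / 2\<close> cancel, leaving the
    plain average of the square roots.\<close>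
  have dhat: "real (r + 1) * dhat N E r powr (real r / 2) = c"
  proof -
    have "dhat N E r powr (real r / 2) = (c / real (r + 1)) powr (2 / real r * (real r / 2))"
      unfolding dhat_def c_def[symmetric] by (simp add: powr_powr)
    also have "2 / real r * (real r / 2) = 1" using r by simp
    finally show ?thesis using c0 by (simp add: field_simps)
  qed
  have N: "N \<ge> 2" using diam by (intro card_ge_2_if_diam_pos) simp
  have "lambda2 (power_adj N E r) \<ge> (1 - 4 * \<epsilon>) * c"
  \<comment> \<open>The test functions require a positive threshold \<open>s\<close>; otherwise
    nonnegativity of the second eigenvalue suffices.\<close>
  proof (cases "(1 - 4 * \<epsilon>) * c > 0")
    case False
    then show ?thesis using lambda2_power_adj_nonneg[OF N, of r] by linarith
  next
    case True
    then have \<epsilon>4: "4 * \<epsilon> < 1" and "c > 0" using c0 by (auto simp: zero_less_mult_iff)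
    \<comment> \<open>The largest radius with \<open>2 * n + r < D\<close>. Then
      \<open>D \<le> 2 * n + r + 2\<close>, and since \<open>r\<close> and 2 are each at most
      \<open>D / 4\<close>, it follows that \<open>D \<le> 4 * n\<close>. Hence
      \<open>r \<le> \<epsilon> * D \<le> 4 * \<epsilon> * n\<close>, the source of the constant
      4.\<close>
    define n where "n = (D - r - 1) div 2"
    have "4 * real r \<le> 4 * \<epsilon> * real D" using r unfolding D_def by simp
    also have "\<dots> \<le> 1 * real D" using \<epsilon>4 by (intro mult_right_mono) auto
    finally have r4: "4 * r \<le> D" by linarith
    have D8: "D \<ge> 8" using diam unfolding D_def .
    have rn: "r \<le> n" and n1: "1 \<le> n" and nD: "2 * n + r < D" and "D \<le> 2 * n + r + 2"
      unfolding n_def using r4 D8 r by auto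
    then have "D \<le> 4 * n" using r4 D8 by auto
    then have "\<epsilon> * real D \<le> \<epsilon> * real (4 * n)" using \<epsilon> by (intro mult_left_mono) auto
    then have "real r \<le> 4 * \<epsilon> * real n" using r unfolding D_def by simp
    then have "(1 - 4 * \<epsilon>) * real n \<le> real (n - r)" using rn by (simp add: of_nat_diff algebra_simps)
    then have "(1 - 4 * \<epsilon>) * real n * c \<le> real (n - r) * c" using c0 by (intro mult_right_mono)
    then show ?thesis
      using nD n1 rn True unfolding D_def c_def
      by (intro lambda2_power_adj_ge[of n r]) (auto simp: mult_ac)
  qed
  then show ?thesis unfolding dhat[symmetric] by (simp add: mult_ac)
qed

end

text \<open>\<open>f\<close> is chosen before the sequences, so the error depends on \<epsilon>
  alone. The floor makes the radius an integer and agrees with \<open>\<epsilon> * diam\<close> when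
  that is one.\<close>

theorem theorem3:
  shows "\<exists>f :: real \<Rightarrow> real. (f \<longlongrightarrow> 0) (at_right 0) \<and>
    (\<forall>\<epsilon> > 0. \<forall>(N :: nat \<Rightarrow> nat) (E :: nat \<Rightarrow> nat \<Rightarrow> nat \<Rightarrow> bool) (r :: nat \<Rightarrow> nat).
       (\<forall>n. is_graph (N n) (E n) \<and> connected_graph (N n) (E n)) \<longrightarrow>
       filterlim (\<lambda>n. real (diam (N n) (E n))) at_top sequentially \<longrightarrow>
       (\<forall>n. r n \<ge> 1 \<and> r n = nat \<lfloor>\<epsilon> * real (diam (N n) (E n))\<rfloor>) \<longrightarrow>
       (\<forall>\<^sub>F n in sequentially.
          lambda2 (power_adj (N n) (E n) (r n)) \<ge>
          (1 - f \<epsilon>) * real (r n + 1) * dhat (N n) (E n) (r n) powr (real (r n) / 2)))"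
proof (intro exI[of _ "\<lambda>\<epsilon>. 4 * \<epsilon>"] conjI allI impI)
  show "((\<lambda>\<epsilon> :: real. 4 * \<epsilon>) \<longlongrightarrow> 0) (at_right 0)"
    by (auto intro!: tendsto_eq_intros)
next
  fix \<epsilon> :: real and N :: "nat \<Rightarrow> nat" and E :: "nat \<Rightarrow> nat \<Rightarrow> nat \<Rightarrow> bool" and r :: "nat \<Rightarrow> nat"
  assume \<epsilon>: "0 < \<epsilon>" and G: "\<forall>n. is_graph (N n) (E n) \<and> connected_graph (N n) (E n)"
    and diam: "filterlim (\<lambda>n. real (diam (N n) (E n))) at_top sequentially"
    and r: "\<forall>n. r n \<ge> 1 \<and> r n = nat \<lfloor>\<epsilon> * real (diam (N n) (E n))\<rfloor>"
  \<comment> \<open>Divergence of the diameter enters through the threshold 8 of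
    \<open>lambda2_power_adj_ge_dhat\<close>.\<close>
  have "\<forall>\<^sub>F n in sequentially. real (diam (N n) (E n)) \<ge> 8"
    using diam unfolding filterlim_at_top by blast
  then show "\<forall>\<^sub>F n in sequentially. lambda2 (power_adj (N n) (E n) (r n)) \<ge>
      (1 - 4 * \<epsilon>) * real (r n + 1) * dhat (N n) (E n) (r n) powr (real (r n) / 2)"
  proof eventually_elim
    case (elim n)
    interpret finite_connected_graph "N n" "E n" using G by unfold_locales auto
    have rn: "r n = nat \<lfloor>\<epsilon> * real (diam (N n) (E n))\<rfloor>" "r n \<ge> 1" using r by blast+
    have "real (r n) \<le> \<epsilon> * real (diam (N n) (E n))"
      unfolding rn(1) using \<epsilon> by (intro of_nat_floor) simp
    then show ?case using elim rn(2) \<epsilon> by (intro lambda2_power_adj_ge_dhat) auto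
  qed
qed

end
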